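(* Let $(X_\infty(i))_{i\in\mathbb{Z}}$ be the infinite Page parking. Then: \begin{enumerate} \item For every $i\in\mathbb{Z}$, $\mathbb{P}(X_\infty(i)=1)=1-e^{-2}$. \item When $n\to+\infty$, $$\frac{X_\infty(1)+\dots+X_\infty(n)}{n}\to 1-e^{-2}\quad\text{in probability.}$$ \end{enumerate}
   Context: Definition of the infinite Page parking. Let $(\xi_i)_{i\in\mathbb{Z}}$ be i.i.d. non-negative random variables with continuous distribution function $F$. The places are the elements of $\mathbb{Z}$. At time $\xi_i$ a car of length two tries to park on the pair of places $(i,i+1)$; it succeeds if and only if both places $i$ and $i+1$ are empty just before time $\xi_i$, and once parked it stays forever. Equivalently, let $P_i\in\{0,1\}$ be the indicator that the car trying to park at $(i,i+1)$ succeeds: $P_i=1$ if and only if, for each $j\in\{i-1,i+1\}$ with $\xi_j<\xi_i$, one has $P_j=0$. In particular $P_i=1$ whenever $i$ is a local minimum, i.e. $\xi_{i-1}>\xi_i<\xi_{i+1}$. Almost surely the $\xi_i$ are pairwise distinct and every integer has local minima of $\xi$ both on its left and on its right at finite distance, so that each $P_i$ is determined by finitely many of the $\xi_j$'s, and the rule defines all $P_i$ almost surely. Set $X_\infty(i)=1$ if $P_{i-1}=1$ or $P_i=1$ (place $i$ is eventually occupied by a car), and $X_\infty(i)=0$ otherwise. *)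

theory Defs
  imports "HOL-Probability.Probability"
begin

(* The configuration x gives the arrival times.  A car is accepted once all its earlier
   neighbours are known to be rejected, and rejected once some earlier neighbour is known to be
   accepted.  The rule is negative in acceptance, so both outcomes are defined simultaneously; a
   car is left undecided only if finitely many arrival times do not determine its outcome, which
   is excluded by the lemmas below for configurations having local minima on both sides of
   every integer. *)

inductive parks :: "(int \<Rightarrow> real) \<Rightarrow> int \<Rightarrow> bool"
  and fails :: "(int \<Rightarrow> real) \<Rightarrow> int \<Rightarrow> bool"
  for x :: "int \<Rightarrow> real"
where
  parks: "(\<And>j. j \<in> {i - 1, i + 1} \<Longrightarrow> x j < x i \<Longrightarrow> fails x j) \<Longrightarrow> parks x i"
| fails: "j \<in> {i - 1, i + 1} \<Longrightarrow> x j < x i \<Longrightarrow> parks x j \<Longrightarrow> fails x i"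

definition X_inf :: "(int \<Rightarrow> real) \<Rightarrow> int \<Rightarrow> nat" where
  "X_inf x i = (if parks x (i - 1) \<or> parks x i then 1 else 0)"

definition page_rule :: "(int \<Rightarrow> real) \<Rightarrow> (int \<Rightarrow> bool) \<Rightarrow> bool" where
  "page_rule x p \<longleftrightarrow> (\<forall>i. p i \<longleftrightarrow> (\<forall>j\<in>{i - 1, i + 1}. x j < x i \<longrightarrow> \<not> p j))"

definition loc_min :: "(int \<Rightarrow> real) \<Rightarrow> int \<Rightarrow> bool" where
  "loc_min x i \<longleftrightarrow> x (i - 1) > x i \<and> x i < x (i + 1)"

definition loc_mins_both_sides :: "(int \<Rightarrow> real) \<Rightarrow> bool" where
  "loc_mins_both_sides x \<longleftrightarrow> (\<forall>i. (\<exists>a\<le>i. loc_min x a) \<and> (\<exists>b\<ge>i. loc_min x b))"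

definition converges_in_prob :: "'a measure \<Rightarrow> (nat \<Rightarrow> 'a \<Rightarrow> real) \<Rightarrow> ('a \<Rightarrow> real) \<Rightarrow> bool" where
  "converges_in_prob M Y Z \<longleftrightarrow>
     (\<forall>n. Y n \<in> borel_measurable M) \<and> Z \<in> borel_measurable M \<and>
     (\<forall>\<epsilon>>0. (\<lambda>n. measure M {\<omega> \<in> space M. \<bar>Y n \<omega> - Z \<omega>\<bar> > \<epsilon>}) \<longlonglongrightarrow> 0)"

lemma parks_fails_exclusive: "\<not> (parks x i \<and> fails x i)"
proof -
  have "parks x i \<Longrightarrow> \<not> fails x i" "fails x i \<Longrightarrow> \<not> parks x i" for i
  proof (induction rule: parks_fails.inducts)
    case (parks i)
    then show ?case by (meson fails.cases)
  next
    case (fails j i)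
    then show ?case by (meson parks.cases)
  qed
  then show ?thesis by blast
qed

lemma earlier_neighbour_induct:
  assumes mins: "loc_mins_both_sides x"
    and step: "\<And>i. (\<And>j. j \<in> {i - 1, i + 1} \<Longrightarrow> x j < x i \<Longrightarrow> Q j) \<Longrightarrow> Q i"
  shows "Q i"
proof -
  obtain a b where ab: "a \<le> i" "loc_min x a" "i \<le> b" "loc_min x b"
    using mins unfolding loc_mins_both_sides_def by blast
  have "k \<in> {a..b} \<Longrightarrow> Q k" for k
  proof (induction "card {l \<in> {a..b}. x l < x k}" arbitrary: k rule: less_induct)
    case less
    show ?case
    proof (rule step)
      fix j assume j: "j \<in> {k - 1, k + 1}" "x j < x k"
      have "j \<noteq> a - 1" "j \<noteq> b + 1"
        using j ab less.prems unfolding loc_min_def by auto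
      then have jab: "j \<in> {a..b}"
        using j less.prems by auto
      have "{l \<in> {a..b}. x l < x j} \<subset> {l \<in> {a..b}. x l < x k}"
        using j jab by auto
      then have "card {l \<in> {a..b}. x l < x j} < card {l \<in> {a..b}. x l < x k}"
        by (intro psubset_card_mono finite_subset[OF _ finite_atLeastAtMost_int[of a b]]) auto
      then show "Q j" using less.hyps jab by blast
    qed
  qed
  then show ?thesis using ab by simp
qed

lemma parks_or_fails:
  assumes "loc_mins_both_sides x"
  shows "parks x i \<or> fails x i"
  by (rule earlier_neighbour_induct[OF assms]) (meson parks_fails.intros)

lemma page_rule_parks:
  assumes "loc_mins_both_sides x"
  shows "page_rule x (parks x)"
  unfolding page_rule_def
  by (meson assms parks.simps parks_or_fails parks_fails_exclusive)

lemma page_rule_unique: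
  assumes "loc_mins_both_sides x" "page_rule x p"
  shows "p = parks x"
proof
  fix i show "p i = parks x i"
  proof (induction rule: earlier_neighbour_induct[OF assms(1)])
    case (1 i)
    then show ?case
      using assms(2) page_rule_parks[OF assms(1)] unfolding page_rule_def by blast
  qed
qed

end

theory Submission
  imports Defs "HOL-Combinatorics.Permutations"
begin

text \<open>The final state has an explicit description.  Follow the arrival times from a car
\<open>i\<close> in one direction for as long as they decrease.  The car at the end of this run has its other
neighbour arriving no earlier, so, as far as this side is concerned, it parks; going back along the
run, the cars alternately fail and park.  Hence one side prevents car \<open>i\<close> from parking exactly when
the run on that side has odd length, and \<open>i\<close> parks iff both runs have even length
(\<open>parks_iff_even_runs\<close>).

Place \<open>i\<close> lies between the cars \<open>i - 1\<close> and \<open>i\<close>.  Comparing their two arrival times gives, when all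
runs are finite, that the place stays empty iff the run to the right from car \<open>i\<close> and
the run to the left from car \<open>i - 1\<close> both have odd length (\<open>X_inf_eq_1_iff\<close>).  These two events depend
on disjoint sets of arrival times, so they are independent, and each is the event that one i.i.d.
sequence starts with a decreasing run of odd length.  By exchangeability and absence of ties, the
run has length at least \<open>m\<close> with probability \<open>1 / (m + 1)!\<close> (\<open>prob_descends\<close>), so it has odd length
with probability
\<open>1/2! - 1/3! + 1/4! - \<dots> = exp (- 1)\<close> (\<open>prob_odd_run\<close>).  The place is therefore empty with probability
\<open>exp (- 1) * exp (- 1) = exp (- 2)\<close>.

For the convergence in probability, the events that two places are empty become almost
independent when the places are far apart: up to an error of order \<open>1 / (m + 1)!\<close> only runs shorter
than \<open>m\<close> count, and then each event depends on the \<open>2 m + 2\<close> cars around its place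
(\<open>prob_two_vacant_le\<close>).  So the variance of the empirical frequency of empty places
tends to 0, and Chebyshev's inequality applies (\<open>weak_law_asymptotically_uncorrelated\<close>).\<close>

section \<open>The final state in terms of decreasing runs\<close>

definition descends :: "(nat \<Rightarrow> real) \<Rightarrow> nat \<Rightarrow> bool" where
  "descends y k \<longleftrightarrow> (\<forall>j<k. y (Suc j) < y j)"

text \<open>The run of \<open>y\<close> is its longest strictly decreasing initial segment, and its length counts the
descents.  An infinite run has neither parity, which is what lets the description of the outcomes
below hold for every configuration, including those where some cars stay undecided.\<close>

definition even_run :: "(nat \<Rightarrow> real) \<Rightarrow> bool" where
  "even_run y \<longleftrightarrow> (\<exists>k. even k \<and> descends y k \<and> \<not> descends y (Suc k))"

definition odd_run :: "(nat \<Rightarrow> real) \<Rightarrow> bool" where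
  "odd_run y \<longleftrightarrow> (\<exists>k. odd k \<and> descends y k \<and> \<not> descends y (Suc k))"

text \<open>The arrival times met when walking from car \<open>i\<close> with step \<open>s\<close>; only \<open>s = 1\<close> and \<open>s = - 1\<close> occur in
the parking model.\<close>

definition ray :: "(int \<Rightarrow> real) \<Rightarrow> int \<Rightarrow> int \<Rightarrow> nat \<Rightarrow> real" where
  "ray x s i k = x (i + s * int k)"

lemma descends_0 [simp]: "descends y 0"
  by (simp add: descends_def)

lemma descends_mono: "descends y n \<Longrightarrow> m \<le> n \<Longrightarrow> descends y m"
  by (auto simp: descends_def)

lemma descends_Suc: "descends y (Suc k) \<longleftrightarrow> y (Suc 0) < y 0 \<and> descends (\<lambda>j. y (Suc j)) k"
  unfolding descends_def by (auto simp: less_Suc_eq_0_disj)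

lemma odd_run_step: "odd_run y \<longleftrightarrow> y (Suc 0) < y 0 \<and> even_run (\<lambda>j. y (Suc j))"
proof
  assume "odd_run y"
  then obtain k where "odd k" "descends y k" "\<not> descends y (Suc k)"
    unfolding odd_run_def by blast
  then show "y (Suc 0) < y 0 \<and> even_run (\<lambda>j. y (Suc j))"
    unfolding even_run_def by (cases k) (auto simp: descends_Suc)
next
  assume "y (Suc 0) < y 0 \<and> even_run (\<lambda>j. y (Suc j))"
  then show "odd_run y"
    unfolding odd_run_def even_run_def by (metis descends_Suc even_Suc)
qed

lemma even_run_step: "even_run y \<longleftrightarrow> (y (Suc 0) < y 0 \<longrightarrow> odd_run (\<lambda>j. y (Suc j)))"
proof
  assume "even_run y"
  then obtain k where "even k" "descends y k" "\<not> descends y (Suc k)"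
    unfolding even_run_def by blast
  then show "y (Suc 0) < y 0 \<longrightarrow> odd_run (\<lambda>j. y (Suc j))"
    unfolding odd_run_def by (cases k) (auto simp: descends_Suc)
next
  assume *: "y (Suc 0) < y 0 \<longrightarrow> odd_run (\<lambda>j. y (Suc j))"
  show "even_run y"
  proof (cases "y (Suc 0) < y 0")
    case True
    then show ?thesis
      using * unfolding odd_run_def even_run_def by (metis descends_Suc even_Suc)
  next
    case False
    then have "descends y 0 \<and> \<not> descends y (Suc 0)" by (simp add: descends_Suc)
    then show ?thesis unfolding even_run_def by (metis even_zero)
  qed
qed

lemma ray_shift: "(\<lambda>j. ray x s i (Suc j)) = ray x s (i + s)"
  by (simp add: ray_def fun_eq_iff algebra_simps)

lemma odd_run_ray: "odd_run (ray x s i) \<longleftrightarrow> x (i + s) < x i \<and> even_run (ray x s (i + s))"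
  by (subst odd_run_step) (simp add: ray_shift, simp add: ray_def)

lemma even_run_ray: "even_run (ray x s i) \<longleftrightarrow> (x (i + s) < x i \<longrightarrow> odd_run (ray x s (i + s)))"
  by (subst even_run_step) (simp add: ray_shift, simp add: ray_def)

text \<open>With its neighbour behind arriving no earlier, car \<open>i\<close> only has to wait for the cars ahead of it in
the run.  The same is true of each later car of the run, because the car behind it in the run
arrives after it; so the outcomes alternate starting from the end of the run, where the car parks.\<close>

lemma run_decides:
  assumes s: "s = 1 \<or> s = - 1"
    and "descends (ray x s i) k" "\<not> descends (ray x s i) (Suc k)" "\<not> x (i - s) < x i"
  shows "if even k then parks x i else fails x i"
  using assms(2-)
proof (induction k arbitrary: i)
  case 0
  then have "\<not> x (i + s) < x i" by (simp add: descends_Suc) (simp add: ray_def)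
  then have "parks x i"
    using s 0 by (intro parks_fails.intros(1)) auto
  then show ?case by simp
next
  case (Suc k)
  then have lt: "x (i + s) < x i" and "descends (ray x s (i + s)) k"
    and "\<not> descends (ray x s (i + s)) (Suc k)"
    by (simp_all add: descends_Suc[of _ k] descends_Suc[of _ "Suc k"] ray_shift)
       (simp_all add: ray_def)
  then have IH: "if even k then parks x (i + s) else fails x (i + s)"
    by (intro Suc.IH) auto
  show ?case
  proof (cases "even k")
    case True
    then have "fails x i"
      using IH lt s by (intro parks_fails.intros(2)[of "i + s"]) auto
    then show ?thesis using True by simp
  next
    case False
    then have "parks x i"
      using IH s Suc.prems(3) by (intro parks_fails.intros(1)) auto
    then show ?thesis using False by simp
  qed
qed

text \<open>An outcome is derived in finitely many steps, and each step passes to an earlier neighbour.  Seen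
from an earlier neighbour, the run that points back has length 0, so only the run that points away
can be responsible for its failure.\<close>

lemma runs_of_outcome:
  "parks x i \<Longrightarrow> even_run (ray x 1 i) \<and> even_run (ray x (-1) i)"
  "fails x i \<Longrightarrow> odd_run (ray x 1 i) \<or> odd_run (ray x (-1) i)"
proof (induction rule: parks_fails.inducts)
  case (parks i)
  then show ?case
    using odd_run_ray[of x "-1" "i + 1"] odd_run_ray[of x 1 "i - 1"]
      even_run_ray[of x 1 i] even_run_ray[of x "-1" i] by auto
next
  case (fails j i)
  then show ?case
    using odd_run_ray[of x 1 i] odd_run_ray[of x "-1" i] by auto
qed

lemma parks_iff_even_runs:
  "parks x i \<longleftrightarrow> even_run (ray x 1 i) \<and> even_run (ray x (-1) i)"
proof
  assume ev: "even_run (ray x 1 i) \<and> even_run (ray x (-1) i)"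
  show "parks x i"
  proof (rule parks_fails.intros(1))
    fix j assume j: "j \<in> {i - 1, i + 1}" "x j < x i"
    then obtain s where s: "s = 1 \<or> s = - 1" "j = i + s" by auto
    with j ev have "odd_run (ray x s j)"
      using even_run_ray[of x s i] by auto
    then obtain k where "odd k" "descends (ray x s j) k" "\<not> descends (ray x s j) (Suc k)"
      unfolding odd_run_def by blast
    then show "fails x j"
      using run_decides[OF s(1), of x j k] j s by auto
  qed
qed (rule runs_of_outcome)

lemma odd_run_iff_not_even_run:
  assumes "\<not> descends y n"
  shows "odd_run y \<longleftrightarrow> \<not> even_run y"
proof -
  define k where "k = (LEAST k. \<not> descends y (Suc k))"
  have "\<exists>k. \<not> descends y (Suc k)"
    using assms by (metis descends_0 not0_implies_Suc)
  then have "\<not> descends y (Suc k)"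
    unfolding k_def by (rule LeastI_ex)
  moreover have "descends y k"
  proof (cases k)
    case (Suc l)
    then have "l < (LEAST k. \<not> descends y (Suc k))" by (simp flip: k_def)
    then show ?thesis using Suc by (blast dest: not_less_Least)
  qed simp
  ultimately have "descends y l \<and> \<not> descends y (Suc l) \<longleftrightarrow> l = k" for l
    using descends_mono[of y l "Suc k"] descends_mono[of y k "Suc l"]
    by (cases l k rule: linorder_cases) auto
  then show ?thesis
    by (simp add: odd_run_def even_run_def)
qed

text \<open>Let \<open>x i < x (i - 1)\<close>, say.  Then car \<open>i\<close> parks iff its run to the right is even; if that run is odd,
then the run to the right from \<open>i - 1\<close> is one longer, hence even, and car \<open>i - 1\<close> parks iff its run
to the left is even.  If \<open>x (i - 1) < x i\<close>, the two cars exchange their roles; in case of a tie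
both runs across the place have length 0.\<close>

lemma X_inf_eq_1_iff:
  assumes "\<not> descends (ray x 1 i) m" "\<not> descends (ray x (-1) (i - 1)) n"
  shows "X_inf x i = 1 \<longleftrightarrow> \<not> (odd_run (ray x 1 i) \<and> odd_run (ray x (-1) (i - 1)))"
proof (cases "x i < x (i - 1)")
  case True
  then show ?thesis
    using odd_run_iff_not_even_run[OF assms(1)] odd_run_iff_not_even_run[OF assms(2)]
      even_run_ray[of x 1 "i - 1"] even_run_ray[of x "-1" i]
    by (auto simp add: X_inf_def parks_iff_even_runs)
next
  case False
  then show ?thesis
    using odd_run_iff_not_even_run[OF assms(1)] odd_run_iff_not_even_run[OF assms(2)]
      even_run_ray[of x 1 "i - 1"] even_run_ray[of x "-1" i]
    by (auto simp add: X_inf_def parks_iff_even_runs)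
qed

section \<open>Decreasing rearrangements of distinct numbers\<close>

text \<open>In a decreasing rearrangement the \<open>j\<close>-th entry is the one exceeded by exactly \<open>j\<close> others.  This
determines the rearrangement, and it also provides one when the entries are distinct.\<close>

definition number_greater :: "(nat \<Rightarrow> real) \<Rightarrow> nat \<Rightarrow> nat \<Rightarrow> nat" where
  "number_greater y n j = card {l. l < n \<and> y j < y l}"

lemma number_greater_descending:
  assumes p: "p permutes {..<n}" and desc: "\<And>j k. j < k \<Longrightarrow> k < n \<Longrightarrow> y (p k) < y (p j)" and j: "j < n"
  shows "number_greater y n (p j) = j"
proof -
  have "{l. l < n \<and> y (p j) < y l} = p ` {..<j}"
  proof (intro equalityI subsetI)
    fix l assume l: "l \<in> {l. l < n \<and> y (p j) < y l}"
    then obtain i where i: "l = p i" "i < n"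
      using permutes_image[OF p] by (metis (mono_tags, lifting) imageE lessThan_iff mem_Collect_eq)
    then have "i < j"
      using desc[of j i] l by (cases i j rule: linorder_cases) auto
    then show "l \<in> p ` {..<j}" using i by auto
  next
    fix l assume "l \<in> p ` {..<j}"
    then obtain i where i: "l = p i" "i < j" by auto
    moreover have "p i < n" using permutes_in_image[OF p, of i] i j by auto
    ultimately show "l \<in> {l. l < n \<and> y (p j) < y l}" using desc[of i j] j by auto
  qed
  then show ?thesis
    unfolding number_greater_def using card_image[OF permutes_inj_on[OF p], of "{..<j}"] by simp
qed

lemma descending_rearrangement_unique:
  fixes y :: "nat \<Rightarrow> real"
  assumes p: "p permutes {..<n}" "\<And>j k. j < k \<Longrightarrow> k < n \<Longrightarrow> y (p k) < y (p j)"
    and q: "q permutes {..<n}" "\<And>j k. j < k \<Longrightarrow> k < n \<Longrightarrow> y (q k) < y (q j)"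
  shows "p = q"
proof -
  have "inv p i = inv q i" if "i < n" for i
  proof -
    have "inv p i < n" "inv q i < n"
      using that permutes_in_image[OF permutes_inv[OF p(1)]] permutes_in_image[OF permutes_inv[OF q(1)]]
      by auto
    then show ?thesis
      using number_greater_descending[of p n y "inv p i", OF p] number_greater_descending[of q n y "inv q i", OF q]
      by (simp add: permutes_inverses[OF p(1)] permutes_inverses[OF q(1)])
  qed
  moreover have "inv p i = inv q i" if "\<not> i < n" for i
    using that permutes_not_in[OF permutes_inv[OF p(1)]] permutes_not_in[OF permutes_inv[OF q(1)]] by auto
  ultimately have "inv p = inv q" by blast
  then show ?thesis
    by (metis p(1) q(1) permutes_inv_inv)
qed

lemma descending_rearrangement_exists:
  fixes y :: "nat \<Rightarrow> real"
  assumes inj: "inj_on y {..<n}"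
  obtains p where "p permutes {..<n}" "\<And>j k. j < k \<Longrightarrow> k < n \<Longrightarrow> y (p k) < y (p j)"
proof -
  \<comment> \<open>Completed by the identity, the ranks form a permutation; its inverse sorts.\<close>
  define r where "r j = (if j < n then number_greater y n j else j)" for j
  have lt: "number_greater y n j < number_greater y n k" if "j < n" "k < n" "y k < y j" for j k
    unfolding number_greater_def using that by (intro psubset_card_mono) auto
  have "number_greater y n j < n" if "j < n" for j
  proof -
    have "{l. l < n \<and> y j < y l} \<subset> {..<n}" using that by auto
    then have "card {l. l < n \<and> y j < y l} < card {..<n}" by (intro psubset_card_mono) auto
    then show ?thesis by (simp add: number_greater_def)
  qed
  moreover have "inj_on r {..<n}"
  proof (rule inj_onI)
    fix j k assume jk: "j \<in> {..<n}" "k \<in> {..<n}" "r j = r k"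
    then have "y j = y k" using lt[of j k] lt[of k j]
      by (cases "y j" "y k" rule: linorder_cases) (auto simp: r_def)
    then show "j = k" using inj jk by (auto dest: inj_onD)
  qed
  ultimately have "bij_betw r {..<n} {..<n}"
    by (intro bij_betw_imageI endo_inj_surj) (auto simp: r_def)
  then have r: "r permutes {..<n}" by (rule bij_imp_permutes) (simp add: r_def)
  show ?thesis
  proof (rule that[OF permutes_inv[OF r]])
    fix j k :: nat assume jk: "j < k" "k < n"
    let ?a = "inv r j" and ?b = "inv r k"
    have ab: "?a < n" "?b < n" using permutes_in_image[OF permutes_inv[OF r]] jk by auto
    moreover have "r ?a = j" "r ?b = k" by (simp_all add: permutes_inverses[OF r])
    ultimately have "number_greater y n ?a < number_greater y n ?b" using jk by (simp add: r_def)
    then have "\<not> y ?a < y ?b" "?a \<noteq> ?b" using lt[of ?b ?a] ab by auto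
    then show "y ?b < y ?a" using inj ab by (metis inj_onD lessThan_iff not_less_iff_gr_or_eq)
  qed
qed

lemma descends_iff: "descends y m \<longleftrightarrow> (\<forall>j k. j < k \<longrightarrow> k < Suc m \<longrightarrow> y k < y j)"
proof
  assume d: "descends y m"
  have "y k < y j" if "j < k" "k < Suc m" for j k
    using that
  proof (induction k)
    case (Suc k)
    then have "y (Suc k) < y k" using d by (simp add: descends_def)
    then show ?case using Suc by (cases "j = k") auto
  qed simp
  then show "\<forall>j k. j < k \<longrightarrow> k < Suc m \<longrightarrow> y k < y j" by blast
qed (simp add: descends_def)

section \<open>Independent, identically distributed families without atoms\<close>

text \<open>At an index outside \<open>J\<close>, the elements of the product space take the constant value \<open>undefined\<close>, so this
coordinate is measurable as well.  This spares index bounds in the measurability of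
conditions on runs.\<close>

lemma measurable_component_any:
  "(\<lambda>w. w i) \<in> borel_measurable (PiM J (\<lambda>_. borel :: real measure))"
proof (cases "i \<in> J")
  case False
  have "w i = undefined" if "w \<in> space (PiM J (\<lambda>_. borel :: real measure))" for w
    using that False unfolding space_PiM by (rule PiE_arb)
  then show ?thesis
    using measurable_cong[of "PiM J (\<lambda>_. borel :: real measure)" "\<lambda>w. w i" "\<lambda>_. undefined" borel]
    by simp
qed simp

lemma pred_descends [measurable (raw)]:
  assumes [measurable]: "\<And>k. Y k \<in> borel_measurable N"
  shows "Measurable.pred N (\<lambda>w. descends (\<lambda>k. Y k w) m)"
  unfolding descends_def by measurable

lemma pred_odd_run [measurable (raw)]:
  assumes [measurable]: "\<And>k. Y k \<in> borel_measurable N"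
  shows "Measurable.pred N (\<lambda>w. odd_run (\<lambda>k. Y k w))"
  unfolding odd_run_def by measurable

lemma pred_even_run [measurable (raw)]:
  assumes [measurable]: "\<And>k. Y k \<in> borel_measurable N"
  shows "Measurable.pred N (\<lambda>w. even_run (\<lambda>k. Y k w))"
  unfolding even_run_def by measurable

locale iid_atomless = prob_space M for M :: "'a measure" +
  fixes \<xi> :: "'i \<Rightarrow> 'a \<Rightarrow> real"
  assumes indep: "indep_vars (\<lambda>_. borel) \<xi> UNIV"
    and identically_distributed: "distr M borel (\<xi> i) = distr M borel (\<xi> j)"
    and atomless: "measure (distr M borel (\<xi> i)) {t} = 0"
begin

lemma rv [measurable]: "\<xi> i \<in> borel_measurable M"
  using indep by (simp add: indep_vars_def)

lemma indep_reindexed: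
  assumes "inj_on f I"
  shows "indep_vars (\<lambda>_. borel) (\<lambda>k. \<xi> (f k)) I"
proof -
  have "indep_vars (\<lambda>k. PiM {f k} (\<lambda>_. borel)) (\<lambda>k \<omega>. restrict (\<lambda>i. \<xi> i \<omega>) {f k}) I"
    using assms
    by (intro indep_vars_restrict[OF indep]) (auto simp: disjoint_family_on_def dest: inj_onD)
  then have "indep_vars (\<lambda>_. borel) (\<lambda>k \<omega>. restrict (\<lambda>i. \<xi> i \<omega>) {f k} (f k)) I"
    by (rule indep_vars_compose2) simp
  then show ?thesis by simp
qed

text \<open>Both sides depend only on the joint law, which is the same product measure for every injective
choice of indices.\<close>

lemma prob_reindexed:
  assumes f: "inj_on f I" and g: "inj_on g I"
    and P: "Measurable.pred (PiM I (\<lambda>_. borel)) P"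
  shows "prob {\<omega> \<in> space M. P (\<lambda>k\<in>I. \<xi> (f k) \<omega>)} = prob {\<omega> \<in> space M. P (\<lambda>k\<in>I. \<xi> (g k) \<omega>)}"
proof (cases "I = {}")
  case False
  let ?N = "PiM I (\<lambda>_. borel :: real measure)"
  have law: "distr M ?N (\<lambda>\<omega>. \<lambda>k\<in>I. \<xi> (h k) \<omega>) = PiM I (\<lambda>k. distr M borel (\<xi> undefined))"
    if "inj_on h I" for h :: "'b \<Rightarrow> 'i"
  proof -
    have "distr M ?N (\<lambda>\<omega>. \<lambda>k\<in>I. \<xi> (h k) \<omega>) = PiM I (\<lambda>k. distr M borel (\<xi> (h k)))"
      using indep_reindexed[OF that] False
      by (subst (asm) indep_vars_iff_distr_eq_PiM') auto
    also have "\<dots> = PiM I (\<lambda>k. distr M borel (\<xi> undefined))"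
      by (intro PiM_cong refl identically_distributed)
    finally show ?thesis .
  qed
  have "prob {\<omega> \<in> space M. P (\<lambda>k\<in>I. \<xi> (h k) \<omega>)}
      = measure (PiM I (\<lambda>k. distr M borel (\<xi> undefined))) {w \<in> space ?N. P w}"
    if "inj_on h I" for h :: "'b \<Rightarrow> 'i"
  proof -
    have "measure (distr M ?N (\<lambda>\<omega>. \<lambda>k\<in>I. \<xi> (h k) \<omega>)) {w \<in> space ?N. P w}
      = prob ((\<lambda>\<omega>. \<lambda>k\<in>I. \<xi> (h k) \<omega>) -` {w \<in> space ?N. P w} \<inter> space M)"
      using P by (intro measure_distr) auto
    also have "(\<lambda>\<omega>. \<lambda>k\<in>I. \<xi> (h k) \<omega>) -` {w \<in> space ?N. P w} \<inter> space M
      = {\<omega> \<in> space M. P (\<lambda>k\<in>I. \<xi> (h k) \<omega>)}"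
      by (auto simp: space_PiM)
    finally show ?thesis unfolding law[OF that] by simp
  qed
  with f g show ?thesis by simp
qed (simp add: restrict_def)

lemma indep_blocks:
  assumes JK: "J \<inter> K = {}"
    and P: "Measurable.pred (PiM J (\<lambda>_. borel)) P" "\<And>w. P (restrict w J) = P w"
    and Q: "Measurable.pred (PiM K (\<lambda>_. borel)) Q" "\<And>w. Q (restrict w K) = Q w"
  shows "prob {\<omega> \<in> space M. P (\<lambda>i. \<xi> i \<omega>) \<and> Q (\<lambda>i. \<xi> i \<omega>)}
    = prob {\<omega> \<in> space M. P (\<lambda>i. \<xi> i \<omega>)} * prob {\<omega> \<in> space M. Q (\<lambda>i. \<xi> i \<omega>)}"
proof -
  let ?A = "{w \<in> space (PiM J (\<lambda>_. borel :: real measure)). P w}"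
  let ?B = "{w \<in> space (PiM K (\<lambda>_. borel :: real measure)). Q w}"
  have "prob ((\<lambda>\<omega>. (\<lambda>i\<in>J. \<xi> i \<omega>, \<lambda>i\<in>K. \<xi> i \<omega>)) -` (?A \<times> ?B) \<inter> space M)
    = prob ((\<lambda>\<omega>. \<lambda>i\<in>J. \<xi> i \<omega>) -` ?A \<inter> space M) * prob ((\<lambda>\<omega>. \<lambda>i\<in>K. \<xi> i \<omega>) -` ?B \<inter> space M)"
    using P(1) Q(1)
    by (intro indep_varD[OF indep_var_restrict[OF indep JK]]) auto
  also have "(\<lambda>\<omega>. (\<lambda>i\<in>J. \<xi> i \<omega>, \<lambda>i\<in>K. \<xi> i \<omega>)) -` (?A \<times> ?B) \<inter> space M
    = {\<omega> \<in> space M. P (\<lambda>i. \<xi> i \<omega>) \<and> Q (\<lambda>i. \<xi> i \<omega>)}"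
    by (auto simp: space_PiM P(2) Q(2))
  also have "(\<lambda>\<omega>. \<lambda>i\<in>J. \<xi> i \<omega>) -` ?A \<inter> space M = {\<omega> \<in> space M. P (\<lambda>i. \<xi> i \<omega>)}"
    by (auto simp: space_PiM P(2))
  also have "(\<lambda>\<omega>. \<lambda>i\<in>K. \<xi> i \<omega>) -` ?B \<inter> space M = {\<omega> \<in> space M. Q (\<lambda>i. \<xi> i \<omega>)}"
    by (auto simp: space_PiM Q(2))
  finally show ?thesis .
qed

text \<open>The joint law of two members is a product, and by Fubini the diagonal is null for it because the
sections of the diagonal are points.\<close>

lemma no_ties:
  assumes "i \<noteq> j"
  shows "AE \<omega> in M. \<xi> i \<omega> \<noteq> \<xi> j \<omega>"
proof -
  have "indep_vars (\<lambda>_. borel) (\<lambda>b. \<xi> (case_bool i j b)) UNIV"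
    using assms by (intro indep_reindexed) (auto simp: inj_on_def split: bool.splits)
  moreover have "(\<lambda>b. \<xi> (case_bool i j b)) = case_bool (\<xi> i) (\<xi> j)"
    "(\<lambda>_. borel) = case_bool (borel :: real measure) borel"
    by (auto simp: fun_eq_iff split: bool.splits)
  ultimately have indep_ij: "indep_var borel (\<xi> i) borel (\<xi> j)"
    unfolding indep_var_def by simp
  define \<mu> where "\<mu> = distr M borel (\<xi> i)"
  interpret \<mu>: prob_space \<mu> unfolding \<mu>_def by (rule prob_space_distr) simp
  interpret \<mu>2: pair_prob_space \<mu> \<mu> ..
  have [measurable_cong]: "sets \<mu> = sets borel" by (simp add: \<mu>_def)
  from indep_ij have "distr M (borel \<Otimes>\<^sub>M borel) (\<lambda>\<omega>. (\<xi> i \<omega>, \<xi> j \<omega>)) = \<mu> \<Otimes>\<^sub>M \<mu>"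
    unfolding indep_var_distribution_eq \<mu>_def by (simp add: identically_distributed[of j i])
  moreover have "AE p in \<mu> \<Otimes>\<^sub>M \<mu>. fst p \<noteq> snd p"
  proof (rule \<mu>2.AE_pair_measure)
    have "AE y in \<mu>. x \<noteq> y" for x
    proof -
      have "emeasure \<mu> {x} = 0"
        using atomless[of i x] by (simp add: \<mu>.emeasure_eq_measure flip: \<mu>_def)
      then have "AE y in \<mu>. y \<notin> {x}"
        by (intro AE_not_in) (auto simp: null_sets_def \<mu>_def)
      then show ?thesis by eventually_elim auto
    qed
    then show "AE x in \<mu>. AE y in \<mu>. fst (x, y) \<noteq> snd (x, y)" by simp
  qed measurable
  ultimately have "AE p in distr M (borel \<Otimes>\<^sub>M borel) (\<lambda>\<omega>. (\<xi> i \<omega>, \<xi> j \<omega>)). fst p \<noteq> snd p"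
    by (simp only:)
  then show ?thesis
    by (subst (asm) AE_distr_iff) auto
qed

text \<open>Almost surely exactly one of the \<open>(m + 1)!\<close> rearrangements of the first \<open>m + 1\<close> entries is
decreasing, and all rearrangements have the same probability of being so.\<close>

lemma prob_descends:
  assumes f: "inj f"
  shows "prob {\<omega> \<in> space M. descends (\<lambda>k. \<xi> (f k) \<omega>) m} = 1 / fact (Suc m)"
proof -
  let ?I = "{..<Suc m}"
  define S where "S = {p. p permutes ?I}"
  define E where "E p = {\<omega> \<in> space M. descends (\<lambda>k. \<xi> (f (p k)) \<omega>) m}" for p
  have local: "descends (restrict y ?I) m = descends y m" for y
    by (auto simp: descends_def)
  have "prob (E p) = prob (E id)" if "p \<in> S" for p
  proof -
    have "inj_on (f \<circ> p) ?I" "inj_on f ?I"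
      using f that by (auto simp: S_def inj_on_def dest: permutes_inj)
    moreover have "Measurable.pred (PiM ?I (\<lambda>_. borel)) (\<lambda>w. descends w m)"
      using pred_descends[OF measurable_component_any] .
    ultimately have "prob {\<omega> \<in> space M. descends (\<lambda>k\<in>?I. \<xi> ((f \<circ> p) k) \<omega>) m}
        = prob {\<omega> \<in> space M. descends (\<lambda>k\<in>?I. \<xi> (f k) \<omega>) m}"
      by (rule prob_reindexed)
    then show ?thesis by (simp add: E_def local)
  qed
  then have "(\<Sum>p\<in>S. prob (E p)) = (\<Sum>p\<in>S. prob (E id))" by (rule sum.cong[OF refl])
  then have "(\<Sum>p\<in>S. prob (E p)) = fact (Suc m) * prob (E id)"
    using card_permutations[of ?I "Suc m"] by (simp add: S_def del: fact_Suc)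
  moreover have "(\<Sum>p\<in>S. prob (E p)) = prob (\<Union>p\<in>S. E p)"
  proof (rule finite_measure_finite_Union[symmetric])
    show "disjoint_family_on E S"
      unfolding disjoint_family_on_def
    proof (intro ballI impI)
      fix p q assume pq: "p \<in> S" "q \<in> S" "p \<noteq> q"
      have "p = q" if "\<omega> \<in> E p" "\<omega> \<in> E q" for \<omega>
        using pq that
        by (intro descending_rearrangement_unique[of p "Suc m" "\<lambda>k. \<xi> (f k) \<omega>" q])
           (simp_all add: E_def S_def descends_iff)
      with pq show "E p \<inter> E q = {}" by blast
    qed
  qed (auto simp: S_def E_def finite_permutations)
  moreover have "prob (\<Union>p\<in>S. E p) = 1"
  proof -
    have "AE \<omega> in M. \<forall>j\<in>?I. \<forall>k\<in>?I. j \<noteq> k \<longrightarrow> \<xi> (f j) \<omega> \<noteq> \<xi> (f k) \<omega>"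
    proof (intro AE_finite_allI)
      fix j k show "AE \<omega> in M. j \<noteq> k \<longrightarrow> \<xi> (f j) \<omega> \<noteq> \<xi> (f k) \<omega>"
        using no_ties[of "f j" "f k"] f by (cases "j = k") (auto simp: inj_eq)
    qed auto
    then have "AE \<omega> in M. \<omega> \<in> (\<Union>p\<in>S. E p)"
    proof (rule AE_mp, intro AE_I2 impI)
      fix \<omega> assume \<omega>: "\<omega> \<in> space M" "\<forall>j\<in>?I. \<forall>k\<in>?I. j \<noteq> k \<longrightarrow> \<xi> (f j) \<omega> \<noteq> \<xi> (f k) \<omega>"
      then have "inj_on (\<lambda>k. \<xi> (f k) \<omega>) ?I" by (auto simp: inj_on_def)
      then show "\<omega> \<in> (\<Union>p\<in>S. E p)"
      proof (rule descending_rearrangement_exists)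
        fix p assume "p permutes ?I"
          "\<And>j k. j < k \<Longrightarrow> k < Suc m \<Longrightarrow> \<xi> (f (p k)) \<omega> < \<xi> (f (p j)) \<omega>"
        then have "p \<in> S" "\<omega> \<in> E p" using \<omega>(1) by (simp_all add: S_def E_def descends_iff)
        then show ?thesis by blast
      qed
    qed
    moreover have "(\<Union>p\<in>S. E p) \<in> events"
      by (intro sets.finite_UN) (auto simp: S_def E_def finite_permutations)
    ultimately show ?thesis by (simp add: prob_eq_1)
  qed
  ultimately show ?thesis by (simp add: E_def field_simps del: fact_Suc)
qed

end

section \<open>The probability of an odd run\<close>

text \<open>Restricting to runs shorter than \<open>m\<close> makes the event depend on finitely many entries.\<close>

definition odd_run_below :: "nat \<Rightarrow> (nat \<Rightarrow> real) \<Rightarrow> bool" where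
  "odd_run_below m y \<longleftrightarrow> (\<exists>k<m. odd k \<and> descends y k \<and> \<not> descends y (Suc k))"

lemma odd_run_below_imp: "odd_run_below m y \<Longrightarrow> odd_run y"
  by (auto simp: odd_run_below_def odd_run_def)

lemma odd_run_cases: "odd_run y \<Longrightarrow> odd_run_below m y \<or> descends y m"
  unfolding odd_run_below_def odd_run_def by (meson descends_mono not_le)

lemma odd_run_below_cong:
  assumes "\<And>k. k \<le> m \<Longrightarrow> y k = z k"
  shows "odd_run_below m y = odd_run_below m z"
proof -
  have "descends y k = descends z k" if "k \<le> m" for k
    using assms that by (simp add: descends_def)
  then show ?thesis by (auto simp: odd_run_below_def)
qed

lemma pred_odd_run_below [measurable (raw)]:
  assumes [measurable]: "\<And>k. Y k \<in> borel_measurable N"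
  shows "Measurable.pred N (\<lambda>w. odd_run_below m (\<lambda>k. Y k w))"
  unfolding odd_run_below_def by measurable

lemma odd_run_below_add_2:
  "odd_run_below (2 * Suc n) y \<longleftrightarrow> odd_run_below (2 * n) y \<or>
     descends y (Suc (2 * n)) \<and> \<not> descends y (Suc (Suc (2 * n)))"
proof -
  have "k < 2 * Suc n \<and> odd k \<longleftrightarrow> k < 2 * n \<and> odd k \<or> k = Suc (2 * n)" for k
    by (auto simp: less_Suc_eq)
  then show ?thesis unfolding odd_run_below_def by (metis (no_types, lifting))
qed

lemma odd_run_below_not_descends: "odd_run_below m y \<Longrightarrow> \<not> descends y m"
  unfolding odd_run_below_def using descends_mono[of y m] by (metis Suc_leI)

lemma inverse_fact_Suc_tendsto_0: "(\<lambda>m. 1 / fact (Suc m)) \<longlonglongrightarrow> (0 :: real)"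
proof (rule Lim_null_comparison[OF _ LIMSEQ_inverse_real_of_nat])
  have "norm (1 / fact (Suc m) :: real) \<le> inverse (real (Suc m))" for m
  proof -
    have "real (Suc m) \<le> fact (Suc m)"
      using fact_ge_self[of "Suc m"] by (metis of_nat_fact of_nat_mono)
    then show ?thesis by (simp add: field_simps del: fact_Suc)
  qed
  then show "\<forall>\<^sub>F m in sequentially. norm (1 / fact (Suc m) :: real) \<le> inverse (real (Suc m))"
    by simp
qed

context iid_atomless
begin

text \<open>A run has length exactly \<open>k\<close> with probability \<open>1 / (k + 1)! - 1 / (k + 2)!\<close>.  The bound is even so
that the terms for odd \<open>k\<close> fit together to an initial segment of the exponential series at
\<open>- 1\<close>, whose two leading terms cancel.\<close>

lemma prob_odd_run_below:
  assumes f: "inj f"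
  shows "prob {\<omega> \<in> space M. odd_run_below (2 * n) (\<lambda>k. \<xi> (f k) \<omega>)}
    = (\<Sum>k<2 * Suc n. (- 1) ^ k / fact k)"
proof (induction n)
  case 0
  then show ?case by (simp add: odd_run_below_def numeral_2_eq_2)
next
  case (Suc n)
  let ?D = "\<lambda>m. {\<omega> \<in> space M. descends (\<lambda>k. \<xi> (f k) \<omega>) m}"
  let ?O = "\<lambda>m. {\<omega> \<in> space M. odd_run_below m (\<lambda>k. \<xi> (f k) \<omega>)}"
  have events: "?D m \<in> events" "?O m \<in> events" for m by measurable
  have split: "?O (2 * Suc n) = ?O (2 * n) \<union> (?D (Suc (2 * n)) - ?D (Suc (Suc (2 * n))))"
    unfolding odd_run_below_add_2 by blast
  have added: "prob (?O (2 * Suc n)) = prob (?O (2 * n)) + prob (?D (Suc (2 * n)) - ?D (Suc (Suc (2 * n))))"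
    unfolding split
  proof (rule finite_measure_Union)
    have "\<not> odd_run_below (2 * n) y" if "descends y (Suc (2 * n))" for y
      using that odd_run_below_not_descends[of "2 * n" y] descends_mono[of y "Suc (2 * n)" "2 * n"]
      by auto
    then show "?O (2 * n) \<inter> (?D (Suc (2 * n)) - ?D (Suc (Suc (2 * n)))) = {}" by blast
  qed (intro sets.Diff events)+
  have step: "prob (?D (Suc (2 * n)) - ?D (Suc (Suc (2 * n))))
      = prob (?D (Suc (2 * n))) - prob (?D (Suc (Suc (2 * n))))"
  proof (rule finite_measure_Diff)
    have "descends y (Suc (2 * n))" if "descends y (Suc (Suc (2 * n)))" for y
      using that by (rule descends_mono) simp
    then show "?D (Suc (Suc (2 * n))) \<subseteq> ?D (Suc (2 * n))" by blast
  qed (rule events)+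
  show ?case
    unfolding added step Suc.IH prob_descends[OF f] by (simp del: fact_Suc)
qed

lemma prob_odd_run:
  assumes f: "inj f"
  shows "prob {\<omega> \<in> space M. odd_run (\<lambda>k. \<xi> (f k) \<omega>)} = exp (- 1)"
proof (rule LIMSEQ_unique)
  let ?p = "prob {\<omega> \<in> space M. odd_run (\<lambda>k. \<xi> (f k) \<omega>)}"
  let ?q = "\<lambda>n. prob {\<omega> \<in> space M. odd_run_below (2 * n) (\<lambda>k. \<xi> (f k) \<omega>)}"
  have "(\<lambda>k. (- 1) ^ k / fact k) sums exp (- 1 :: real)"
    using exp_converges[of "- 1 :: real"] by (simp add: divide_inverse_commute)
  then have "(\<lambda>n. \<Sum>k<n. (- 1) ^ k / fact k) \<longlonglongrightarrow> exp (- 1 :: real)"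
    by (simp add: sums_def)
  moreover have "strict_mono (\<lambda>n. 2 * Suc n)" by (simp add: strict_mono_def)
  ultimately show "?q \<longlonglongrightarrow> exp (- 1)"
    unfolding prob_odd_run_below[OF f] by (rule LIMSEQ_subseq_LIMSEQ[unfolded comp_def])
  have lower: "?q n \<le> ?p" for n
    by (intro finite_measure_mono) (auto intro: odd_run_below_imp)
  have upper: "?p \<le> ?q n + 1 / fact (Suc (2 * n))" for n
  proof -
    have "?p \<le> prob ({\<omega> \<in> space M. odd_run_below (2 * n) (\<lambda>k. \<xi> (f k) \<omega>)}
        \<union> {\<omega> \<in> space M. descends (\<lambda>k. \<xi> (f k) \<omega>) (2 * n)})"
      by (intro finite_measure_mono) (auto dest: odd_run_cases)
    also have "\<dots> \<le> ?q n + prob {\<omega> \<in> space M. descends (\<lambda>k. \<xi> (f k) \<omega>) (2 * n)}"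
      by (intro measure_Un_le) measurable
    finally show ?thesis unfolding prob_descends[OF f] .
  qed
  have close: "\<bar>?q n - ?p\<bar> \<le> 1 / fact (Suc (2 * n))" for n
  proof -
    have "(0 :: real) \<le> 1 / fact (Suc (2 * n))" by simp
    then show ?thesis unfolding abs_le_iff using lower[of n] upper[of n] by linarith
  qed
  have "(\<lambda>n. 1 / fact (Suc (2 * n))) \<longlonglongrightarrow> (0 :: real)"
    by (rule LIMSEQ_subseq_LIMSEQ[OF inverse_fact_Suc_tendsto_0, unfolded comp_def])
       (simp add: strict_mono_def)
  then have "(\<lambda>n. ?q n - ?p) \<longlonglongrightarrow> 0"
    by (rule Lim_null_comparison[rotated]) (simp only: real_norm_def close eventually_True)
  then show "?q \<longlonglongrightarrow> ?p" by (rule LIM_zero_cancel)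
qed

lemma finite_run_AE:
  assumes f: "inj f"
  shows "AE \<omega> in M. \<exists>m. \<not> descends (\<lambda>k. \<xi> (f k) \<omega>) m"
proof -
  let ?N = "{\<omega> \<in> space M. \<forall>m. descends (\<lambda>k. \<xi> (f k) \<omega>) m}"
  have "prob ?N \<le> 1 / fact (Suc m)" for m
    unfolding prob_descends[OF f, symmetric] by (intro finite_measure_mono) auto
  then have "prob ?N \<le> 0"
    by (intro LIMSEQ_le_const[OF inverse_fact_Suc_tendsto_0]) auto
  then have "AE \<omega> in M. \<omega> \<notin> ?N"
    by (subst prob_eq_0[symmetric]) (auto simp: measure_le_0_iff)
  then show ?thesis by (rule AE_mp) (auto intro!: AE_I2)
qed

end

section \<open>A weak law of large numbers for asymptotically uncorrelated events\<close>

text \<open>In the second moment of the centred sum, the pairs at distance at most \<open>K\<close> contribute at most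
\<open>n (2 K + 1)\<close> and the others at most \<open>n\<^sup>2 \<delta>\<close>.  An upper bound on the probabilities of the
intersections is enough, since the second moment is only estimated from above.\<close>

lemma (in prob_space) weak_law_asymptotically_uncorrelated:
  assumes A: "\<And>k. A k \<in> events" and p: "\<And>k. prob (A k) = p"
    and decay: "\<And>\<delta>. \<delta> > 0 \<Longrightarrow> \<exists>K. \<forall>i j. i + K < j \<longrightarrow> prob (A i \<inter> A j) \<le> p\<^sup>2 + \<delta>"
    and \<epsilon>: "\<epsilon> > 0"
  shows "(\<lambda>n. prob {\<omega> \<in> space M. \<bar>(\<Sum>k=1..n. indicator (A k) \<omega>) / real n - p\<bar> > \<epsilon>}) \<longlonglongrightarrow> 0"
proof -
  note [measurable] = A
  have p01: "0 \<le> p" "p \<le> 1" using p[of 0] prob_le_1[of "A 0"] by auto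
  define D where "D n = {\<omega> \<in> space M. \<bar>(\<Sum>k=1..n. indicator (A k) \<omega>) / real n - p\<bar> > \<epsilon>}" for n
  define c where "c i j = expectation (\<lambda>\<omega>. (indicator (A i) \<omega> - p) * (indicator (A j) \<omega> - p))" for i j
  have c: "c i j = prob (A i \<inter> A j) - p\<^sup>2" for i j
  proof -
    have "c i j = expectation (\<lambda>\<omega>. indicator (A i \<inter> A j) \<omega> - p * indicator (A i) \<omega>
        - p * indicator (A j) \<omega> + p\<^sup>2)"
      unfolding c_def
      by (intro Bochner_Integration.integral_cong)
         (auto simp: indicator_def power2_eq_square algebra_simps)
    also have "\<dots> = prob (A i \<inter> A j) - p * prob (A i) - p * prob (A j) + p\<^sup>2"
    proof -
      have "integrable M (indicator (A i) :: _ \<Rightarrow> real)" "integrable M (indicator (A j) :: _ \<Rightarrow> real)"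
        "integrable M (indicator (A i \<inter> A j) :: _ \<Rightarrow> real)"
        by (auto intro!: integrable_real_indicator A sets.Int simp: emeasure_eq_measure)
      moreover have "A i \<inter> space M = A i" "A j \<inter> space M = A j"
        using sets.sets_into_space[OF A] by blast+
      ultimately show ?thesis by (simp add: prob_space Int_assoc)
    qed
    finally show ?thesis by (simp add: p power2_eq_square)
  qed
  have bound: "\<exists>K. \<forall>n\<ge>1. prob (D n) \<le> (\<delta> + real (2 * K + 1) / real n) / \<epsilon>\<^sup>2"
    if \<delta>: "\<delta> > 0" for \<delta>
  proof -
    obtain K where K: "\<And>i j. i + K < j \<Longrightarrow> prob (A i \<inter> A j) \<le> p\<^sup>2 + \<delta>"
      using decay[OF \<delta>] by blast
    have c_le: "c i j \<le> \<delta> + (if j \<in> {i - K..i + K} then 1 else 0)" for i j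
    proof (cases "j \<in> {i - K..i + K}")
      case True
      have "c i j \<le> 1" unfolding c by (smt (verit) prob_le_1 zero_le_power2)
      then show ?thesis using True \<delta> by simp
    next
      case False
      then have "i + K < j \<or> j + K < i" by auto
      then have "prob (A i \<inter> A j) \<le> p\<^sup>2 + \<delta>"
        using K[of i j] K[of j i] by (auto simp: Int_commute)
      then show ?thesis using False unfolding c by simp
    qed
    show ?thesis
    proof (intro exI[of _ K] allI impI)
      fix n :: nat assume n: "1 \<le> n"
      define S where "S \<omega> = (\<Sum>k=1..n. indicator (A k) \<omega> - p)" for \<omega>
      have S2: "S \<omega> ^ 2 = (\<Sum>i=1..n. \<Sum>j=1..n. (indicator (A i) \<omega> - p) * (indicator (A j) \<omega> - p))" for \<omega>
        unfolding S_def power2_eq_square sum_product ..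
      have int: "integrable M (\<lambda>\<omega>. (indicator (A i) \<omega> - p) * (indicator (A j) \<omega> - p))" for i j
        by (rule integrable_const_bound[of _ 1])
           (auto simp: abs_mult indicator_def p01 intro!: mult_le_one AE_I2)
      have "expectation (\<lambda>\<omega>. S \<omega> ^ 2) = (\<Sum>i=1..n. \<Sum>j=1..n. c i j)"
        unfolding S2 c_def using int by simp
      also have "\<dots> \<le> (\<Sum>i=1..n. real n * \<delta> + real (2 * K + 1))"
      proof (rule sum_mono)
        fix i assume "i \<in> {1..n}"
        have "(\<Sum>j=1..n. c i j) \<le> (\<Sum>j=1..n. \<delta> + (if j \<in> {i - K..i + K} then 1 else 0))"
          by (intro sum_mono c_le)
        also have "\<dots> = real n * \<delta> + real (card ({1..n} \<inter> {i - K..i + K}))"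
          by (simp add: sum.distrib del: atLeastAtMost_iff Int_atLeastAtMost flip: sum.inter_restrict)
        also have "card ({1..n} \<inter> {i - K..i + K}) \<le> card {i - K..i + K}"
          by (intro card_mono) auto
        also have "card {i - K..i + K} \<le> 2 * K + 1" by simp
        finally show "(\<Sum>j=1..n. c i j) \<le> real n * \<delta> + real (2 * K + 1)" by simp
      qed
      finally have ES: "expectation (\<lambda>\<omega>. S \<omega> ^ 2) \<le> real n * (real n * \<delta> + real (2 * K + 1))"
        by simp
      have "D n \<subseteq> {\<omega> \<in> space M. real n * \<epsilon> \<le> \<bar>S \<omega>\<bar>}"
      proof
        fix \<omega> assume "\<omega> \<in> D n"
        moreover have "S \<omega> = real n * ((\<Sum>k=1..n. indicator (A k) \<omega>) / real n - p)"
          using n by (simp add: S_def sum_subtractf field_simps)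
        ultimately show "\<omega> \<in> {\<omega> \<in> space M. real n * \<epsilon> \<le> \<bar>S \<omega>\<bar>}"
          using n by (simp add: D_def abs_mult)
      qed
      moreover have [measurable]: "S \<in> borel_measurable M" unfolding S_def by measurable
      ultimately have "prob (D n) \<le> prob {\<omega> \<in> space M. real n * \<epsilon> \<le> \<bar>S \<omega>\<bar>}"
        by (intro finite_measure_mono) auto
      also have "\<dots> \<le> expectation (\<lambda>\<omega>. S \<omega> ^ 2) / (real n * \<epsilon>)\<^sup>2"
        using n \<epsilon> int by (intro second_moment_method) (auto simp: S2)
      also have "\<dots> \<le> real n * (real n * \<delta> + real (2 * K + 1)) / (real n * \<epsilon>)\<^sup>2"
        by (intro divide_right_mono ES) simp
      also have "\<dots> = (\<delta> + real (2 * K + 1) / real n) / \<epsilon>\<^sup>2"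
        using n \<epsilon> by (simp add: power2_eq_square field_simps)
      finally show "prob (D n) \<le> (\<delta> + real (2 * K + 1) / real n) / \<epsilon>\<^sup>2" .
    qed
  qed
  have "(\<lambda>n. prob (D n)) \<longlonglongrightarrow> 0"
  proof (rule LIMSEQ_I)
    fix r :: real assume r: "r > 0"
    then obtain K where K: "\<And>n. n \<ge> 1 \<Longrightarrow> prob (D n) \<le> (r * \<epsilon>\<^sup>2 / 2 + real (2 * K + 1) / real n) / \<epsilon>\<^sup>2"
      using bound[of "r * \<epsilon>\<^sup>2 / 2"] \<epsilon> by auto
    have lim: "(\<lambda>n. (r * \<epsilon>\<^sup>2 / 2 + real (2 * K + 1) / real n) / \<epsilon>\<^sup>2) \<longlonglongrightarrow> (r * \<epsilon>\<^sup>2 / 2 + 0) / \<epsilon>\<^sup>2"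
      using \<epsilon> by (intro tendsto_intros lim_const_over_n) auto
    have "(r * \<epsilon>\<^sup>2 / 2 + 0) / \<epsilon>\<^sup>2 < r" using r \<epsilon> by simp
    with lim have "\<forall>\<^sub>F n in sequentially. (r * \<epsilon>\<^sup>2 / 2 + real (2 * K + 1) / real n) / \<epsilon>\<^sup>2 < r"
      by (rule order_tendstoD(2))
    then have "\<forall>\<^sub>F n in sequentially. prob (D n) < r"
      using eventually_ge_at_top[of 1] by eventually_elim (use K in fastforce)
    then show "\<exists>N. \<forall>n\<ge>N. norm (prob (D n) - 0) < r"
      by (auto simp: eventually_sequentially)
  qed
  then show ?thesis by (simp add: D_def)
qed

section \<open>Vacant places of the infinite Page parking\<close>

text \<open>Place \<open>i\<close> lies between the cars \<open>i - 1\<close> and \<open>i\<close>; the two runs considered start at these cars and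
point away from the place.\<close>

definition vacant :: "(int \<Rightarrow> real) \<Rightarrow> int \<Rightarrow> bool" where
  "vacant x i \<longleftrightarrow> odd_run (ray x 1 i) \<and> odd_run (ray x (-1) (i - 1))"

definition vacant_within :: "nat \<Rightarrow> (int \<Rightarrow> real) \<Rightarrow> int \<Rightarrow> bool" where
  "vacant_within m x i \<longleftrightarrow> odd_run_below m (ray x 1 i) \<and> odd_run_below m (ray x (-1) (i - 1))"

lemma ray_eq: "ray x s i = (\<lambda>k. x (i + s * int k))"
  by (simp add: ray_def fun_eq_iff)

lemma inj_ray: "s \<noteq> 0 \<Longrightarrow> inj (\<lambda>k. i + s * int k)"
  by (simp add: inj_on_def)

lemma pred_vacant [measurable (raw)]:
  assumes [measurable]: "\<And>j. X j \<in> borel_measurable N"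
  shows "Measurable.pred N (\<lambda>w. vacant (\<lambda>j. X j w) i)"
  unfolding vacant_def ray_eq by measurable

lemma pred_vacant_within [measurable (raw)]:
  assumes [measurable]: "\<And>j. X j \<in> borel_measurable N"
  shows "Measurable.pred N (\<lambda>w. vacant_within m (\<lambda>j. X j w) i)"
  unfolding vacant_within_def ray_eq by measurable

lemma vacant_within_cong:
  assumes "\<And>j. j \<in> {i - 1 - int m..i + int m} \<Longrightarrow> x j = y j"
  shows "vacant_within m x i = vacant_within m y i"
  unfolding vacant_within_def ray_eq using assms
  by (intro arg_cong2[where f = "(\<and>)"] odd_run_below_cong) auto

lemma pred_X_inf [measurable (raw)]:
  assumes [measurable]: "\<And>j. Y j \<in> borel_measurable N"
  shows "(\<lambda>w. X_inf (\<lambda>j. Y j w) i) \<in> measurable N (count_space UNIV)"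
  unfolding X_inf_def parks_iff_even_runs ray_eq by measurable

locale page_parking = iid_atomless M \<xi> for M :: "'a measure" and \<xi> :: "int \<Rightarrow> 'a \<Rightarrow> real"
begin

lemma X_inf_vacant_AE: "AE \<omega> in M. X_inf (\<lambda>j. \<xi> j \<omega>) i = 1 \<longleftrightarrow> \<not> vacant (\<lambda>j. \<xi> j \<omega>) i"
proof -
  have "AE \<omega> in M. \<exists>m. \<not> descends (ray (\<lambda>j. \<xi> j \<omega>) s k) m" if "s \<noteq> 0" for s k
    unfolding ray_eq by (rule finite_run_AE[OF inj_ray[OF that]])
  from this[of 1 i] this[of "-1" "i - 1"]
  have "AE \<omega> in M. \<exists>m. \<not> descends (ray (\<lambda>j. \<xi> j \<omega>) 1 i) m"
    "AE \<omega> in M. \<exists>m. \<not> descends (ray (\<lambda>j. \<xi> j \<omega>) (-1) (i - 1)) m" by simp_all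
  then show ?thesis
    by eventually_elim (use X_inf_eq_1_iff in \<open>auto simp: vacant_def\<close>)
qed

lemma prob_vacant: "prob {\<omega> \<in> space M. vacant (\<lambda>j. \<xi> j \<omega>) i} = exp (- 2)"
proof -
  have "prob {\<omega> \<in> space M. odd_run (ray (\<lambda>j. \<xi> j \<omega>) 1 i) \<and> odd_run (ray (\<lambda>j. \<xi> j \<omega>) (-1) (i - 1))}
    = prob {\<omega> \<in> space M. odd_run (ray (\<lambda>j. \<xi> j \<omega>) 1 i)}
      * prob {\<omega> \<in> space M. odd_run (ray (\<lambda>j. \<xi> j \<omega>) (-1) (i - 1))}"
  proof (rule indep_blocks[of "{i..}" "{..i - 1}"])
    show "Measurable.pred (PiM {i..} (\<lambda>_. borel)) (\<lambda>w. odd_run (ray w 1 i))"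
      "Measurable.pred (PiM {..i - 1} (\<lambda>_. borel)) (\<lambda>w. odd_run (ray w (-1) (i - 1)))"
      unfolding ray_eq by (intro pred_odd_run measurable_component_any)+
  qed (auto simp: ray_eq)
  also have "\<dots> = exp (- 1) * exp (- 1)"
    unfolding ray_eq by (simp only: prob_odd_run[OF inj_ray])
  finally show ?thesis by (simp add: vacant_def flip: exp_add)
qed

text \<open>Discarding runs of length at least \<open>m\<close> changes each of the two events on a set of probability at
most \<open>2 / (m + 1)!\<close>, and makes them depend on disjoint blocks of cars.  Since the restricted events
are smaller, the product of their probabilities is at most the product of the original ones.\<close>

lemma prob_two_vacant_le:
  assumes far: "i + (2 * int m + 1) < j"
  shows "prob {\<omega> \<in> space M. vacant (\<lambda>j. \<xi> j \<omega>) i \<and> vacant (\<lambda>j. \<xi> j \<omega>) j}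
    \<le> (exp (- 2))\<^sup>2 + 4 / fact (Suc m)"
proof -
  let ?V = "\<lambda>i. {\<omega> \<in> space M. vacant (\<lambda>j. \<xi> j \<omega>) i}"
  let ?W = "\<lambda>i. {\<omega> \<in> space M. vacant_within m (\<lambda>j. \<xi> j \<omega>) i}"
  let ?R = "\<lambda>s i. {\<omega> \<in> space M. descends (ray (\<lambda>j. \<xi> j \<omega>) s i) m}"
  let ?B = "\<lambda>i. {i - 1 - int m..i + int m}"
  let ?E = "\<lambda>i. ?R 1 i \<union> ?R (- 1) (i - 1)"
  have [measurable]: "?R s i \<in> events" for s i
    unfolding ray_eq by measurable
  have R: "prob (?R s i) = 1 / fact (Suc m)" if "s \<noteq> 0" for s i
    unfolding ray_eq by (rule prob_descends[OF inj_ray[OF that]])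
  have E: "prob (?E i) \<le> 2 / fact (Suc m)" for i
    using measure_Un_le[of "?R 1 i" M "?R (- 1) (i - 1)"] by (simp add: R del: fact_Suc)
  have W: "prob (?W i) \<le> exp (- 2)" for i
  proof -
    have "?W i \<subseteq> ?V i" by (auto simp: vacant_def vacant_within_def intro: odd_run_below_imp)
    then have "prob (?W i) \<le> prob (?V i)" by (intro finite_measure_mono) measurable
    then show ?thesis by (simp add: prob_vacant)
  qed
  have "{\<omega> \<in> space M. vacant (\<lambda>j. \<xi> j \<omega>) i \<and> vacant (\<lambda>j. \<xi> j \<omega>) j} \<subseteq> (?W i \<inter> ?W j) \<union> (?E i \<union> ?E j)"
    using odd_run_cases[of _ m] by (auto simp: vacant_def vacant_within_def)
  then have "prob {\<omega> \<in> space M. vacant (\<lambda>j. \<xi> j \<omega>) i \<and> vacant (\<lambda>j. \<xi> j \<omega>) j}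
      \<le> prob ((?W i \<inter> ?W j) \<union> (?E i \<union> ?E j))"
    by (intro finite_measure_mono) measurable
  also have "\<dots> \<le> prob (?W i \<inter> ?W j) + prob (?E i \<union> ?E j)"
    by (intro measure_Un_le) measurable
  also have "prob (?E i \<union> ?E j) \<le> prob (?E i) + prob (?E j)"
    by (intro measure_Un_le) measurable
  also have "prob (?W i \<inter> ?W j) = prob (?W i) * prob (?W j)"
  proof -
    have eq: "?W i \<inter> ?W j = {\<omega> \<in> space M. vacant_within m (\<lambda>j. \<xi> j \<omega>) i \<and> vacant_within m (\<lambda>j. \<xi> j \<omega>) j}"
      by blast
    have disj: "?B i \<inter> ?B j = {}" using far by auto
    have meas: "Measurable.pred (PiM (?B k) (\<lambda>_. borel)) (\<lambda>w. vacant_within m w k)" for k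
      by (intro pred_vacant_within measurable_component_any)
    have loc: "vacant_within m (restrict w (?B k)) k = vacant_within m w k" for w k
      by (intro vacant_within_cong) simp
    show ?thesis
      unfolding eq
      by (rule indep_blocks[of "?B i" "?B j" "\<lambda>w. vacant_within m w i" "\<lambda>w. vacant_within m w j",
            OF disj meas loc meas loc])
  qed
  also have "prob (?W i) * prob (?W j) \<le> (exp (- 2))\<^sup>2"
    unfolding power2_eq_square by (intro mult_mono W) auto
  finally show ?thesis using E[of i] E[of j] by simp
qed

end

theorem theorem4:
  fixes M :: "'a measure" and \<xi> :: "int \<Rightarrow> 'a \<Rightarrow> real" and F :: "real \<Rightarrow> real"
  assumes "prob_space M"
    and "prob_space.indep_vars M (\<lambda>_. borel) \<xi> UNIV"
    and "\<And>i. cdf (distr M borel (\<xi> i)) = F"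
    and "continuous_on UNIV F"
    and "\<And>i. AE \<omega> in M. \<xi> i \<omega> \<ge> 0"
  shows "(\<forall>i. measure M {\<omega> \<in> space M. X_inf (\<lambda>j. \<xi> j \<omega>) i = 1} = 1 - exp (-2))
    \<and> converges_in_prob M
        (\<lambda>n \<omega>. (\<Sum>k=1..n. real (X_inf (\<lambda>j. \<xi> j \<omega>) (int k))) / real n)
        (\<lambda>_. 1 - exp (-2))"
proof -
  interpret prob_space M by fact
  have rv: "random_variable borel (\<xi> i)" for i
    using assms(2) by (simp add: indep_vars_def)
  have rd: "real_distribution (distr M borel (\<xi> i))" for i
    using rv by simp
  interpret page_parking M \<xi>
  proof
    show "indep_vars (\<lambda>_. borel) \<xi> UNIV" by fact
    show "distr M borel (\<xi> i) = distr M borel (\<xi> j)" for i j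
      by (rule cdf_unique[OF rd rd]) (simp add: assms(3))
    show "measure (distr M borel (\<xi> i)) {t} = 0" for i t
      using finite_borel_measure.isCont_cdf[OF real_distribution.finite_borel_measure_M[OF rd[of i]], of t]
        assms(4) by (simp add: assms(3) continuous_on_eq_continuous_at)
  qed
  let ?X = "\<lambda>\<omega> i. X_inf (\<lambda>j. \<xi> j \<omega>) i"
  define A where "A k = {\<omega> \<in> space M. vacant (\<lambda>j. \<xi> j \<omega>) (int k)}" for k
  have A: "A k \<in> events" "prob (A k) = exp (- 2)" for k
    unfolding A_def by measurable (rule prob_vacant)
  have "prob {\<omega> \<in> space M. ?X \<omega> i = 1} = 1 - exp (- 2)" for i
  proof -
    have "prob {\<omega> \<in> space M. ?X \<omega> i = 1} = prob {\<omega> \<in> space M. \<not> vacant (\<lambda>j. \<xi> j \<omega>) i}"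
      by (intro measure_eq_AE) (use X_inf_vacant_AE[of i] in auto)
    also have "\<dots> = 1 - prob {\<omega> \<in> space M. vacant (\<lambda>j. \<xi> j \<omega>) i}"
      by (intro prob_neg) measurable
    finally show ?thesis by (simp add: prob_vacant)
  qed
  moreover have "converges_in_prob M (\<lambda>n \<omega>. (\<Sum>k=1..n. real (?X \<omega> (int k))) / real n) (\<lambda>_. 1 - exp (- 2))"
    unfolding converges_in_prob_def
  proof (intro conjI allI impI)
    fix \<epsilon> :: real assume \<epsilon>: "\<epsilon> > 0"
    have "(\<lambda>n. prob {\<omega> \<in> space M. \<bar>(\<Sum>k=1..n. indicator (A k) \<omega>) / real n - exp (- 2)\<bar> > \<epsilon>}) \<longlonglongrightarrow> 0"
    proof (rule weak_law_asymptotically_uncorrelated[OF A _ \<epsilon>])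
      fix \<delta> :: real assume \<delta>: "\<delta> > 0"
      have "(\<lambda>m. 4 * (1 / fact (Suc m)) :: real) \<longlonglongrightarrow> 4 * 0"
        by (intro tendsto_mult tendsto_const inverse_fact_Suc_tendsto_0)
      then have "\<forall>\<^sub>F m in sequentially. 4 * (1 / fact (Suc m)) < \<delta>"
        using \<delta> by (intro order_tendstoD(2)) auto
      then obtain m where m: "4 / fact (Suc m) < \<delta>"
        by (auto simp: eventually_sequentially simp del: fact_Suc)
      have "prob (A i \<inter> A j) \<le> (exp (- 2))\<^sup>2 + \<delta>" if "i + (2 * m + 1) < j" for i j
      proof -
        have "A i \<inter> A j = {\<omega> \<in> space M. vacant (\<lambda>j. \<xi> j \<omega>) (int i) \<and> vacant (\<lambda>j. \<xi> j \<omega>) (int j)}"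
          by (auto simp: A_def)
        then show ?thesis
          using prob_two_vacant_le[of "int i" m "int j"] that m by simp
      qed
      then show "\<exists>K. \<forall>i j. i + K < j \<longrightarrow> prob (A i \<inter> A j) \<le> (exp (- 2))\<^sup>2 + \<delta>" by blast
    qed
    moreover have "\<forall>\<^sub>F n in sequentially.
      prob {\<omega> \<in> space M. \<bar>(\<Sum>k=1..n. indicator (A k) \<omega>) / real n - exp (- 2)\<bar> > \<epsilon>}
      = prob {\<omega> \<in> space M. \<bar>(\<Sum>k=1..n. real (?X \<omega> (int k))) / real n - (1 - exp (- 2))\<bar> > \<epsilon>}"
      \<comment> \<open>For \<open>n = 0\<close> both averages are 0, so the frequencies add up to 1 only from \<open>n = 1\<close> on.\<close>
      using eventually_ge_at_top[of 1]
    proof eventually_elim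
      case (elim n)
      have "AE \<omega> in M. \<forall>k. ?X \<omega> (int k) = 1 \<longleftrightarrow> \<not> vacant (\<lambda>j. \<xi> j \<omega>) (int k)"
        using X_inf_vacant_AE by (simp add: AE_all_countable)
      then have "AE \<omega> in M. (\<Sum>k=1..n. real (?X \<omega> (int k))) = real n - (\<Sum>k=1..n. indicator (A k) \<omega>)"
      proof (rule AE_mp, intro AE_I2 impI)
        fix \<omega> assume \<omega>: "\<omega> \<in> space M" "\<forall>k. ?X \<omega> (int k) = 1 \<longleftrightarrow> \<not> vacant (\<lambda>j. \<xi> j \<omega>) (int k)"
        have "real (?X \<omega> (int k)) = 1 - indicator (A k) \<omega>" for k
          using \<omega>(1) \<omega>(2)[rule_format, of k] by (auto simp: A_def X_inf_def split: if_splits)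
        then show "(\<Sum>k=1..n. real (?X \<omega> (int k))) = real n - (\<Sum>k=1..n. indicator (A k) \<omega>)"
          by (simp add: sum_subtractf)
      qed
      then have "AE \<omega> in M. (\<Sum>k=1..n. real (?X \<omega> (int k))) / real n - (1 - exp (- 2))
          = - ((\<Sum>k=1..n. indicator (A k) \<omega>) / real n - exp (- 2))"
        by eventually_elim (use elim in \<open>simp add: diff_divide_distrib\<close>)
      then show ?case
        using A(1) by (intro measure_eq_AE) (auto elim!: eventually_mono)
    qed
    ultimately show "(\<lambda>n. prob {\<omega> \<in> space M.
        \<bar>(\<Sum>k=1..n. real (?X \<omega> (int k))) / real n - (1 - exp (- 2))\<bar> > \<epsilon>}) \<longlonglongrightarrow> 0"
      by (rule Lim_transform_eventually)
  qed measurable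
  ultimately show ?thesis by blast
qed

end
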